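(* Let $\delta_k>0$ with $\delta_k\to0$ and let $g_k\in H_2$ with $\|g_k-g\|\le\delta_k$. Let $\Gamma$ be Morozov's discrepancy principle with parameter $\rho>1$ and assume that $\lim_{k\to\infty}\Gamma(\delta_k,g_k)=\infty$. Assume that there exists a $J$-minimizing solution $u^\dagger$ of $Ku=g$ which satisfies the source condition $K^*p^\dagger\in\partial J(u^\dagger)$ with source element $p^\dagger\in H_2$. Write $n_k=\Gamma(\delta_k,g_k)$. Then, as $k\to\infty$, $$\|K\mathcal{R}_{n_k}(g_k)-g\|=\mathcal{O}\big(t_{n_k}^{-1}\big)\quad\text{and}\quad\|\mathcal{R}^*_{n_k}(g_k)\|=\mathcal{O}(1),$$ and each weak cluster point of $\{\mathcal{R}^*_{n_k}(g_k)\}_{k\in\mathbb{N}}$ is a minimizer of $G(\cdot,g)$ over $H_2$.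
   Context: $H_1,H_2$ are separable (real) Hilbert spaces, $K:H_1\to H_2$ is linear and bounded with adjoint $K^*$, and $J:H_1\to\mathbb{R}\cup\{\infty\}$ is convex, lower semicontinuous and proper with domain $D(J)=\{u: J(u)<\infty\}$. It is assumed that for every $c\in\mathbb{R}$ every sequence in $\{u\in H_1:\|Ku\|^2+J(u)\le c\}$ has a weakly convergent subsequence in $H_1$. The element $g\in H_2$ is attainable, i.e. $Ku=g$ for some $u\in D(J)$. A $J$-minimizing solution of $Ku=g$ is a minimizer of $J(u)$ subject to $Ku=g$. Augmented Lagrangian method: $\{\tau_n\}_{n\ge1}$ is a fixed sequence of positive numbers, $t_n:=\sum_{k=1}^n\tau_k$, with $t_n\to+\infty$ and $\bar\tau:=\sup_k\tau_k<\infty$. Given data $g^\delta$ and a fixed starting element $p_0^\delta=p_0\in H_2$, for $n=1,2,\dots$ $$u_n^\delta\in\operatorname{argmin}_{u\in H_1}\Big(\tfrac{\tau_n}{2}\|Ku-g^\delta\|^2+J(u)-\langle p_{n-1}^\delta,Ku-g^\delta\rangle\Big),\qquad p_n^\delta=p_{n-1}^\delta+\tau_n(g^\delta-Ku_n^\delta).$$ Set $\mathcal{R}_n(g^\delta):=u_n^\delta$ and $\mathcal{R}_n^*(g^\delta):=p_n^\delta$. Morozov's discrepancy principle with $\rho>1$ is the stopping rule $\Gamma(\delta,g^\delta):=\min\{n\in\mathbb{N}, n\ge1:\ \|Ku_n^\delta-g^\delta\|<\rho\delta\}$ (this minimum exists whenever $\|g^\delta-g\|\le\delta$). $J^*(v)=\sup_{u\in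 H_1}(\langle v,u\rangle-J(u))$ is the Legendre-Fenchel conjugate and $G(p,g)=J^*(K^*p)-\langle p,g\rangle$ for $p\in H_2$. *)

theory Defs
  imports "HOL-Analysis.Analysis" "HOL-Library.Landau_Symbols"
begin

definition convex_ereal :: "('a::real_vector \<Rightarrow> ereal) \<Rightarrow> bool" where
  "convex_ereal J \<longleftrightarrow>
    (\<forall>x y. \<forall>a\<ge>0. \<forall>b\<ge>0. a + b = 1 \<longrightarrow>
      J (a *\<^sub>R x + b *\<^sub>R y) \<le> ereal a * J x + ereal b * J y)"

definition lower_semicontinuous :: "('a::topological_space \<Rightarrow> ereal) \<Rightarrow> bool" where
  "lower_semicontinuous J \<longleftrightarrow> (\<forall>x. J x \<le> Liminf (at x) J)"

definition domain :: "('a \<Rightarrow> ereal) \<Rightarrow> 'a set" where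
  "domain J = {u. J u < \<infinity>}"

text \<open>Functionals take values in the reals extended by \<open>+\<infinity>\<close> only, so the
  value \<open>-\<infinity>\<close> of type \<^typ>\<open>ereal\<close> is excluded here.\<close>

definition proper :: "('a \<Rightarrow> ereal) \<Rightarrow> bool" where
  "proper J \<longleftrightarrow> (\<forall>u. J u \<noteq> -\<infinity>) \<and> domain J \<noteq> {}"

definition subdifferential :: "('a::real_inner \<Rightarrow> ereal) \<Rightarrow> 'a \<Rightarrow> 'a set" where
  "subdifferential J u = {\<xi>. \<forall>v. J u + ereal (\<xi> \<bullet> (v - u)) \<le> J v}"

definition conjugate :: "('a::real_inner \<Rightarrow> ereal) \<Rightarrow> 'a \<Rightarrow> ereal" where
  "conjugate J v = (SUP u. ereal (v \<bullet> u) - J u)"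

text \<open>The coarsest topology making all bounded linear functionals continuous.\<close>

definition weak_topology :: "'a::real_normed_vector topology" where
  "weak_topology =
    topology_generated_by {f -` U | (f :: 'a \<Rightarrow> real) U. bounded_linear f \<and> open U}"

text \<open>Every limit of a weakly convergent subsequence is a weak cluster point in
  this (topological) sense.\<close>

definition weak_cluster_point :: "(nat \<Rightarrow> 'a::real_normed_vector) \<Rightarrow> 'a \<Rightarrow> bool" where
  "weak_cluster_point x l \<longleftrightarrow>
    (\<forall>U. openin weak_topology U \<and> l \<in> U \<longrightarrow> (\<exists>\<^sub>F k in sequentially. x k \<in> U))"

definition weakly_precompact_sublevels ::
    "('a::real_inner \<Rightarrow> 'b::real_inner) \<Rightarrow> ('a \<Rightarrow> ereal) \<Rightarrow> bool" where
  "weakly_precompact_sublevels K J \<longleftrightarrow>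
    (\<forall>c::real. \<forall>x::nat \<Rightarrow> 'a.
      (\<forall>n. x n \<in> {u. ereal ((norm (K u))\<^sup>2) + J u \<le> ereal c}) \<longrightarrow>
      (\<exists>r l. strict_mono (r :: nat \<Rightarrow> nat) \<and>
        limitin weak_topology (x \<circ> r) l sequentially))"

definition attainable ::
    "('a \<Rightarrow> 'b) \<Rightarrow> ('a \<Rightarrow> ereal) \<Rightarrow> 'b \<Rightarrow> bool" where
  "attainable K J g \<longleftrightarrow> (\<exists>u\<in>domain J. K u = g)"

definition J_minimizing_solution ::
    "('a \<Rightarrow> 'b) \<Rightarrow> ('a \<Rightarrow> ereal) \<Rightarrow> 'b \<Rightarrow> 'a \<Rightarrow> bool" where
  "J_minimizing_solution K J g u \<longleftrightarrow> is_arg_min J (\<lambda>v. K v = g) u"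

definition alm_objective ::
    "('a::real_inner \<Rightarrow> 'b::real_inner) \<Rightarrow> ('a \<Rightarrow> ereal) \<Rightarrow> real \<Rightarrow> 'b \<Rightarrow> 'b \<Rightarrow> 'a \<Rightarrow> ereal" where
  "alm_objective K J \<tau> y q u =
    ereal (\<tau> / 2 * (norm (K u - y))\<^sup>2) + J u - ereal (q \<bullet> (K u - y))"

text \<open>\<open>u\<close> and \<open>p\<close> are primal and dual iterates of the augmented Lagrangian method
  with step sizes \<open>\<tau>\<close>, dual starting element \<open>p\<^sub>0\<close> and data \<open>y\<close>. The primal
  iterates need not be unique; the value \<open>u 0\<close> plays no role.\<close>

definition alm_iterates ::
    "('a::real_inner \<Rightarrow> 'b::real_inner) \<Rightarrow> ('a \<Rightarrow> ereal) \<Rightarrow> (nat \<Rightarrow> real) \<Rightarrow> 'b \<Rightarrow> 'b \<Rightarrow>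
     (nat \<Rightarrow> 'a) \<Rightarrow> (nat \<Rightarrow> 'b) \<Rightarrow> bool" where
  "alm_iterates K J \<tau> p\<^sub>0 y u p \<longleftrightarrow>
    p 0 = p\<^sub>0 \<and>
    (\<forall>n\<ge>1. is_arg_min (alm_objective K J (\<tau> n) y (p (n - 1))) (\<lambda>_. True) (u n) \<and>
           p n = p (n - 1) + \<tau> n *\<^sub>R (y - K (u n)))"

definition morozov ::
    "('a \<Rightarrow> 'b::real_normed_vector) \<Rightarrow> (nat \<Rightarrow> 'b \<Rightarrow> 'a) \<Rightarrow> real \<Rightarrow> real \<Rightarrow> 'b \<Rightarrow> nat" where
  "morozov K R \<rho> \<delta> y = (LEAST n. n \<ge> 1 \<and> norm (K (R n y) - y) < \<rho> * \<delta>)"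

text \<open>\<^const>\<open>adjoint\<close> is a choice operator; by the Riesz representation theorem it is
  the Hilbert space adjoint whenever \<open>K\<close> is bounded linear and \<open>'a\<close> is complete.\<close>

definition dual_functional ::
    "('a::real_inner \<Rightarrow> 'b::real_inner) \<Rightarrow> ('a \<Rightarrow> ereal) \<Rightarrow> 'b \<Rightarrow> 'b \<Rightarrow> ereal" where
  "dual_functional K J p y = conjugate J (adjoint K p) - ereal (p \<bullet> y)"

end

theory Submission
  imports Defs
begin

text \<open>The dual iterates \<open>p n\<close> are proximal point iterates for the dual functional
  \<open>G(p, y)\<close>, with \<open>z n = K (u n) - y\<close> a subgradient at \<open>p n\<close>. Gueler's energy estimate,
  compared with the source element \<open>p_dag\<close> (a minimizer of \<open>G(p, g)\<close>), gives for noise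
  level \<open>\<delta>\<close>

  \<open>norm (p_dag - p n)^2 + t n^2 * norm (z n)^2
    \<le> norm (p_dag - p 0)^2 + 2 * t n * \<delta> * norm (p_dag - p n)\<close>.

  One step before stopping \<open>norm (z n) \<ge> \<rho> * \<delta>\<close>, which forces \<open>\<delta> = O(1 / t n)\<close>; boundedness of the
  step sizes carries this over to the stopping index. Both rates follow from it, and so does
  \<open>G(p n, g) \<longrightarrow> min G\<close>. As \<open>G(p, g)\<close> is a supremum of continuous affine functions of \<open>p\<close>, weak
  cluster points are minimizers.\<close>

section \<open>First-order optimality, Riesz representation and the adjoint\<close>

text \<open>Divide by \<open>s\<close> and let \<open>s\<close> tend to 0. This extracts the
  first-order condition both for the Riesz representer and for the minimization step of the
  augmented Lagrangian method.\<close>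

lemma linear_coefficient_nonneg:
  fixes a b :: real
  assumes "\<And>s. 0 < s \<Longrightarrow> s \<le> 1 \<Longrightarrow> 0 \<le> s * a + s\<^sup>2 * b"
  shows "0 \<le> a"
proof (rule ccontr)
  assume "\<not> 0 \<le> a"
  then have a: "a < 0" by simp
  \<comment> \<open>Chosen so that \<open>s * b \<le> - a / 2\<close>, which leaves
    \<open>a + s * b\<close> negative.\<close>
  define s where "s = min 1 (- a / (2 * (\<bar>b\<bar> + 1)))"
  have s: "0 < s" "s \<le> 1" using a by (auto simp: s_def field_simps)
  have "s * b \<le> s * (\<bar>b\<bar> + 1)" using s by (intro mult_left_mono) auto
  also have "\<dots> \<le> - a / (2 * (\<bar>b\<bar> + 1)) * (\<bar>b\<bar> + 1)"
    by (intro mult_right_mono) (auto simp: s_def)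
  also have "\<dots> = - a / 2" by (simp add: divide_simps)
  finally have "a + s * b < 0" using a by simp
  then have "s * (a + s * b) < 0" using s by (simp add: mult_pos_neg)
  with assms[OF s] show False by (simp add: power2_eq_square algebra_simps)
qed

text \<open>The representer is the minimizer of \<open>\<parallel>x\<parallel>\<^sup>2 / 2 - f x\<close>; the
  parallelogram law makes minimizing sequences Cauchy.\<close>

lemma riesz_representation:
  fixes f :: "'a::{real_inner, complete_space} \<Rightarrow> real"
  assumes f: "bounded_linear f"
  obtains w where "\<And>x. f x = w \<bullet> x"
proof -
  interpret bounded_linear f by fact
  define \<phi> where "\<phi> x = (norm x)\<^sup>2 / 2 - f x" for x
  obtain C where C: "\<And>x. norm (f x) \<le> norm x * C" using bounded by blast
  have lower: "- C\<^sup>2 / 2 \<le> \<phi> x" for x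
  proof -
    have "f x \<le> norm x * C" using C[of x] by simp
    moreover have "0 \<le> (norm x - C)\<^sup>2" by simp
    ultimately show ?thesis by (simp add: \<phi>_def power2_eq_square algebra_simps)
  qed
  define m where "m = (INF x. \<phi> x)"
  have bdd: "bdd_below (range \<phi>)" using lower by (intro bdd_belowI[of _ "- C\<^sup>2 / 2"]) auto
  have m: "m \<le> \<phi> x" for x unfolding m_def using bdd by (rule cINF_lower) simp
  have "\<exists>x. \<phi> x < m + inverse (real (Suc n))" for n
  proof -
    have "(INF x. \<phi> x) < m + inverse (real (Suc n))" unfolding m_def by simp
    then show ?thesis by (subst (asm) cINF_less_iff[OF _ bdd]) auto
  qed
  then obtain X where X: "\<And>n. \<phi> (X n) < m + inverse (real (Suc n))" by metis
  have parallelogram: "(norm (x - y))\<^sup>2 / 4 = \<phi> x + \<phi> y - 2 * \<phi> ((1 / 2) *\<^sub>R (x + y))" for x y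
    unfolding \<phi>_def power2_norm_eq_inner
    by (simp add: scaleR add inner_simps inner_commute field_simps)
  have "Cauchy X"
  proof (rule metric_CauchyI)
    fix e :: real assume e: "e > 0"
    \<comment> \<open>The midpoint has value at least \<open>m\<close>, so by
      \<open>parallelogram\<close> two points with values below \<open>m + \<epsilon>\<close> have
      squared distance below \<open>8 * \<epsilon>\<close>.\<close>
    obtain n where n: "inverse (real (Suc n)) < e\<^sup>2 / 8" using e reals_Archimedean[of "e\<^sup>2 / 8"] by auto
    have "dist (X i) (X j) < e" if "i \<ge> n" "j \<ge> n" for i j
    proof -
      have "inverse (real (Suc i)) \<le> inverse (real (Suc n))" "inverse (real (Suc j)) \<le> inverse (real (Suc n))"
        using that by (auto intro!: le_imp_inverse_le)
      with X[of i] X[of j] m[of "(1 / 2) *\<^sub>R (X i + X j)"] n parallelogram[of "X i" "X j"]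
      have "(norm (X i - X j))\<^sup>2 < e\<^sup>2" by linarith
      then show ?thesis using e power2_less_imp_less by (fastforce simp: dist_norm)
    qed
    then show "\<exists>M. \<forall>i\<ge>M. \<forall>j\<ge>M. dist (X i) (X j) < e" by blast
  qed
  then obtain w where w: "X \<longlonglongrightarrow> w" using Cauchy_convergent convergent_def by blast
  have "(\<lambda>n. \<phi> (X n)) \<longlonglongrightarrow> \<phi> w" unfolding \<phi>_def by (intro tendsto_intros tendsto w) simp
  moreover have "(\<lambda>n. m + inverse (real (Suc n))) \<longlonglongrightarrow> m + 0"
    by (intro tendsto_intros LIMSEQ_inverse_real_of_nat)
  ultimately have \<phi>_w: "\<phi> w \<le> m"
    using X by (intro LIMSEQ_le[where Y = "\<lambda>n. m + inverse (real (Suc n))"]) (auto intro: less_imp_le)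
  \<comment> \<open>Variation of the minimizer in direction \<open>x\<close>; the directions
    \<open>x\<close> and \<open>- x\<close> together give equality.\<close>
  have half: "0 \<le> w \<bullet> x - f x" for x
  proof (rule linear_coefficient_nonneg)
    fix s :: real
    have "\<phi> w \<le> \<phi> (w + s *\<^sub>R x)" using \<phi>_w m order_trans by blast
    then show "0 \<le> s * (w \<bullet> x - f x) + s\<^sup>2 * ((norm x)\<^sup>2 / 2)"
      unfolding \<phi>_def power2_norm_eq_inner
      by (simp add: scaleR add inner_simps inner_commute power2_eq_square field_simps)
  qed
  have "f x = w \<bullet> x" for x using half[of x] half[of "- x"] by (simp add: neg)
  then show ?thesis using that by blast
qed

lemma adjoint_inner:
  fixes K :: "'a::{real_inner, complete_space} \<Rightarrow> 'b::real_inner"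
  assumes K: "bounded_linear K"
  shows "adjoint K q \<bullet> x = q \<bullet> K x"
proof -
  have "\<exists>w. \<forall>x. q \<bullet> K x = w \<bullet> x" for q
    using riesz_representation[OF bounded_linear_compose[OF bounded_linear_inner_right K], of q] by metis
  then obtain h where "\<And>q x. q \<bullet> K x = h q \<bullet> x" by metis
  then have h: "\<forall>x q. K x \<bullet> q = x \<bullet> h q" by (simp add: inner_commute)
  then have "adjoint K = h" by (rule adjoint_unique)
  with h show ?thesis by (simp add: inner_commute)
qed

section \<open>Energy estimate for the proximal point method\<close>

text \<open>\<open>G n\<close> and \<open>Gq\<close> stand for the values of the functional at \<open>p n\<close> and \<open>q\<close>; its value at
  \<open>p 0\<close> may be infinite, so the induction starts at 1.\<close>

lemma proximal_point_energy:
  fixes p z :: "nat \<Rightarrow> 'b::real_inner" and G \<tau> :: "nat \<Rightarrow> real"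
  assumes \<tau>: "\<And>n. n \<ge> 1 \<Longrightarrow> \<tau> n > 0"
    and step: "\<And>n. n \<ge> 1 \<Longrightarrow> p n = p (n - 1) - \<tau> n *\<^sub>R z n"
    and sub: "\<And>m n. m \<ge> 1 \<Longrightarrow> n \<ge> 1 \<Longrightarrow> G n + z n \<bullet> (p m - p n) \<le> G m"
    and subq: "\<And>n. n \<ge> 1 \<Longrightarrow> G n + z n \<bullet> (q - p n) \<le> Gq"
    and "n \<ge> 1"
  shows "(\<Sum>k=1..n. \<tau> k) * (G n - Gq) + (norm (q - p n))\<^sup>2 / 2
      + (\<Sum>k=1..n. \<tau> k)\<^sup>2 * (norm (z n))\<^sup>2 / 2 \<le> (norm (q - p 0))\<^sup>2 / 2"
  using \<open>n \<ge> 1\<close>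
proof (induction n rule: dec_induct)
  \<comment> \<open>The subgradient inequality at \<open>q\<close>, inserted into the expansion of
    the square of \<open>q - p (n - 1)\<close>.\<close>
  have descent: "\<tau> n * (G n - Gq) + (norm (q - p n))\<^sup>2 / 2 + (\<tau> n)\<^sup>2 * (norm (z n))\<^sup>2 / 2
      \<le> (norm (q - p (n - 1)))\<^sup>2 / 2" if "n \<ge> 1" for n
  proof -
    have "\<tau> n * (G n + z n \<bullet> (q - p n)) \<le> \<tau> n * Gq"
      using subq[OF that] \<tau>[OF that] by (simp add: mult_left_mono)
    moreover have "p (n - 1) = p n + \<tau> n *\<^sub>R z n" using step[OF that] by simp
    ultimately show ?thesis
      unfolding power2_norm_eq_inner
      by (simp add: inner_simps inner_commute power2_eq_square field_simps)
  qed
  {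
    case base
    show ?case using descent[of 1] by simp
  next
    case (step n)
    define T where "T = (\<Sum>k=1..n. \<tau> k)"
    have T: "T \<ge> 0" unfolding T_def using \<tau> by (intro sum_nonneg less_imp_le) auto
    have n: "n \<ge> 1" and tau: "\<tau> (Suc n) > 0" using step \<tau> by auto
    have eq: "p n = p (Suc n) + \<tau> (Suc n) *\<^sub>R z (Suc n)" using assms(2)[of "Suc n"] by simp
    have "\<tau> (Suc n) * (norm (z (Suc n)))\<^sup>2 = z (Suc n) \<bullet> (p n - p (Suc n))"
      by (simp add: eq power2_norm_eq_inner)
    then have desc: "G (Suc n) + \<tau> (Suc n) * (norm (z (Suc n)))\<^sup>2 \<le> G n"
      using sub[of n "Suc n"] n by simp
    \<comment> \<open>Monotonicity of subgradients: the sum of the two inequalities between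
      \<open>p n\<close> and \<open>p (Suc n)\<close>. By Cauchy-Schwarz the norms of the
      \<open>z n\<close> do not increase.\<close>
    have "\<tau> (Suc n) * (z (Suc n) \<bullet> z (Suc n)) \<le> \<tau> (Suc n) * (z n \<bullet> z (Suc n))"
      using sub[of n "Suc n"] sub[of "Suc n" n] n by (simp add: eq inner_simps)
    then have "(norm (z (Suc n)))\<^sup>2 \<le> z n \<bullet> z (Suc n)"
      using tau by (simp add: power2_norm_eq_inner)
    also have "\<dots> \<le> norm (z n) * norm (z (Suc n))" by (rule norm_cauchy_schwarz)
    finally have "norm (z (Suc n)) \<le> norm (z n)"
      by (cases "z (Suc n) = 0") (auto simp: power2_eq_square)
    then have "T\<^sup>2 * (norm (z (Suc n)))\<^sup>2 \<le> T\<^sup>2 * (norm (z n))\<^sup>2"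
      by (intro mult_left_mono power_mono) auto
    \<comment> \<open>In the expansion of \<open>(T + \<tau> (Suc n))\<^sup>2\<close>, the mixed
      term is paid for by the decrease of \<open>G\<close> weighted with \<open>T\<close>, the
      square of \<open>T\<close> by the monotone norms, and the square of
      \<open>\<tau> (Suc n)\<close> by \<open>descent\<close>.\<close>
    moreover have "T * (G (Suc n) + \<tau> (Suc n) * (norm (z (Suc n)))\<^sup>2) \<le> T * G n"
      using desc T by (rule mult_left_mono)
    moreover have "(\<Sum>k=1..Suc n. \<tau> k) = T + \<tau> (Suc n)" by (simp add: T_def)
    ultimately show ?case
      using descent[of "Suc n"] step(3) unfolding T_def[symmetric]
      by (simp add: power2_eq_square field_simps)
  }
qed

section \<open>The augmented Lagrangian method as a proximal point method\<close>

text \<open>Minimality is tested on the segment from \<open>u\<close> to \<open>v\<close>, where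
  convexity bounds \<open>J\<close> by its chord. As \<open>q + \<tau> *\<^sub>R (y - K u)\<close>
  is the updated dual iterate, the result says that its image under the adjoint of \<open>K\<close>
  is a subgradient of \<open>J\<close> at \<open>u\<close>.\<close>

lemma alm_step_subgradient:
  fixes K :: "'a::real_inner \<Rightarrow> 'b::real_inner"
  assumes K: "linear K" and J: "convex_ereal J" "proper J"
    and min: "is_arg_min (alm_objective K J \<tau> y q) (\<lambda>_. True) u"
  shows "\<bar>J u\<bar> \<noteq> \<infinity>"
    and "J u + ereal ((q + \<tau> *\<^sub>R (y - K u)) \<bullet> K (v - u)) \<le> J v"
proof -
  interpret linear K by fact
  have J_ninf: "J w \<noteq> -\<infinity>" for w using J by (simp add: proper_def)
  have le: "alm_objective K J \<tau> y q u \<le> alm_objective K J \<tau> y q w" for w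
    using min by (auto simp: is_arg_min_def not_less)
  obtain u\<^sub>0 where "J u\<^sub>0 < \<infinity>" using J by (auto simp: proper_def domain_def)
  then obtain j\<^sub>0 where "J u\<^sub>0 = ereal j\<^sub>0" using J_ninf[of u\<^sub>0] by (cases "J u\<^sub>0") auto
  then have "J u \<noteq> \<infinity>" using le[of u\<^sub>0] by (auto simp: alm_objective_def)
  then show fin: "\<bar>J u\<bar> \<noteq> \<infinity>" using J_ninf[of u] by auto
  then obtain j where j: "J u = ereal j" by auto
  show "J u + ereal ((q + \<tau> *\<^sub>R (y - K u)) \<bullet> K (v - u)) \<le> J v"
  proof (cases "J v")
    case (real j')
    have "0 \<le> \<tau> * ((K u - y) \<bullet> K (v - u)) + j' - j - q \<bullet> K (v - u)"
    proof (rule linear_coefficient_nonneg)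
      fix s :: real assume s: "0 < s" "s \<le> 1"
      define w where "w = (1 - s) *\<^sub>R u + s *\<^sub>R v"
      have "J w \<le> ereal (1 - s) * J u + ereal s * J v"
        using J s unfolding convex_ereal_def w_def by simp
      then have J_w: "J w \<le> ereal (j + s * (j' - j))" by (simp add: j real algebra_simps)
      then obtain jw where jw: "J w = ereal jw" using J_ninf[of w] by (cases "J w") auto
      have K_w: "K w - y = (K u - y) + s *\<^sub>R K (v - u)"
        by (simp add: w_def add scale diff algebra_simps)
      have "\<tau> / 2 * (norm (K u - y))\<^sup>2 + j - q \<bullet> (K u - y)
          \<le> \<tau> / 2 * (norm (K w - y))\<^sup>2 + jw - q \<bullet> (K w - y)"
        using le[of w] by (simp add: alm_objective_def j jw)
      also have "\<dots> \<le> \<tau> / 2 * (norm (K w - y))\<^sup>2 + (j + s * (j' - j)) - q \<bullet> (K w - y)"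
        using J_w jw by simp
      also have "(norm (K w - y))\<^sup>2
          = (norm (K u - y))\<^sup>2 + 2 * s * ((K u - y) \<bullet> K (v - u)) + s\<^sup>2 * (norm (K (v - u)))\<^sup>2"
        unfolding K_w power2_norm_eq_inner
        by (simp only: inner_add_left inner_add_right inner_scaleR_left inner_scaleR_right
            inner_commute[of "K (v - u)" "K u - y"] power2_eq_square)
           (simp add: algebra_simps)
      also have "q \<bullet> (K w - y) = q \<bullet> (K u - y) + s * (q \<bullet> K (v - u))"
        by (simp add: K_w inner_add_right)
      finally show "0 \<le> s * (\<tau> * ((K u - y) \<bullet> K (v - u)) + j' - j - q \<bullet> K (v - u))
          + s\<^sup>2 * (\<tau> / 2 * (norm (K (v - u)))\<^sup>2)"
        by (simp add: field_simps)
    qed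
    then show ?thesis by (simp add: j real inner_simps algebra_simps)
  qed (use J_ninf in auto)
qed

text \<open>The source element \<open>q\<close> minimizes the dual functional for the exact data \<open>K x\<close>, and replacing
  them by \<open>y\<close> changes the optimality gap at \<open>p n\<close> by at most \<open>\<delta> * norm (q - p n)\<close>.\<close>

lemma alm_noisy_energy:
  fixes K :: "'a::real_inner \<Rightarrow> 'b::real_inner" and \<tau> :: "nat \<Rightarrow> real"
  assumes K: "linear K" and J: "convex_ereal J" "proper J"
    and \<tau>: "\<And>n. n \<ge> 1 \<Longrightarrow> \<tau> n > 0"
    and alm: "alm_iterates K J \<tau> p\<^sub>0 y u p"
    and noise: "norm (y - K x) \<le> \<delta>"
    and J_x: "J x = ereal j"
    and source: "\<And>v. J x + ereal (q \<bullet> K (v - x)) \<le> J v"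
    and n: "n \<ge> 1"
  defines "T \<equiv> \<Sum>k=1..n. \<tau> k"
  shows "(norm (q - p n))\<^sup>2 + T\<^sup>2 * (norm (K (u n) - y))\<^sup>2
      \<le> (norm (q - p\<^sub>0))\<^sup>2 + 2 * (T * \<delta> * norm (q - p n))"
    and "\<And>v. ereal (p n \<bullet> (K v - K x)) - J v
      \<le> ereal (- j + (norm (q - p\<^sub>0))\<^sup>2 / (2 * T) + \<delta> * norm (q - p n))"
proof -
  interpret linear K by fact
  have T: "T > 0" unfolding T_def using n \<tau> by (intro sum_pos) auto
  have min: "is_arg_min (alm_objective K J (\<tau> n) y (p (n - 1))) (\<lambda>_. True) (u n)"
    and step: "p n = p (n - 1) + \<tau> n *\<^sub>R (y - K (u n))" if "n \<ge> 1" for n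
    using alm that by (auto simp: alm_iterates_def)
  define h where "h n = real_of_ereal (J (u n))" for n
  have h: "J (u n) = ereal (h n)" if "n \<ge> 1" for n
    using alm_step_subgradient(1)[OF K J min[OF that]] by (simp add: h_def ereal_real)
  have sub: "ereal (h n + p n \<bullet> K (v - u n)) \<le> J v" if "n \<ge> 1" for n v
    using alm_step_subgradient(2)[OF K J min[OF that], of v] step[OF that] h[OF that] by simp
  define z where "z n = K (u n) - y" for n
  \<comment> \<open>By equality in the Fenchel-Young inequality, \<open>G n\<close> and
    \<open>Gq\<close> are the values at \<open>p n\<close> and \<open>q\<close> of the dual
    functional for the data \<open>y\<close>.\<close>
  define G where "G n = p n \<bullet> z n - h n" for n
  define Gq where "Gq = q \<bullet> (K x - y) - j"
  have "T * (G n - Gq) + (norm (q - p n))\<^sup>2 / 2 + T\<^sup>2 * (norm (z n))\<^sup>2 / 2 \<le> (norm (q - p 0))\<^sup>2 / 2"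
    unfolding T_def
  proof (rule proximal_point_energy)
    show "p n = p (n - 1) - \<tau> n *\<^sub>R z n" if "n \<ge> 1" for n
      using step[OF that] by (simp add: z_def algebra_simps)
    show "G n + z n \<bullet> (p m - p n) \<le> G m" if "m \<ge> 1" "n \<ge> 1" for m n
      using sub[OF that(1), of "u n"] h[OF that(2)]
      by (simp add: G_def z_def diff inner_simps inner_commute algebra_simps)
    show "G n + z n \<bullet> (q - p n) \<le> Gq" if "n \<ge> 1" for n
      using source[of "u n"] h[OF that] J_x
      by (simp add: G_def Gq_def z_def diff inner_simps inner_commute algebra_simps)
  qed (use \<tau> n in auto)
  then have energy: "T * (G n - Gq) + (norm (q - p n))\<^sup>2 / 2 + T\<^sup>2 * (norm (z n))\<^sup>2 / 2
      \<le> (norm (q - p\<^sub>0))\<^sup>2 / 2"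
    using alm by (simp add: alm_iterates_def)
  have "\<bar>(q - p n) \<bullet> (y - K x)\<bar> \<le> norm (q - p n) * norm (y - K x)"
    by (rule Cauchy_Schwarz_ineq2)
  also have "\<dots> \<le> norm (q - p n) * \<delta>" using noise by (rule mult_left_mono) simp
  finally have perturb: "\<bar>(q - p n) \<bullet> (y - K x)\<bar> \<le> \<delta> * norm (q - p n)" by (simp add: mult.commute)
  \<comment> \<open>Weak duality: for the exact data \<open>K x\<close> the dual functional is at
    least \<open>- j\<close>, its value at \<open>q\<close>. Passing to \<open>y\<close> costs the
    inner product bounded in \<open>perturb\<close>.\<close>
  have "h n + p n \<bullet> K (x - u n) \<le> j" using sub[OF n, of x] J_x by simp
  then have "Gq - G n \<le> - ((q - p n) \<bullet> (y - K x))"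
    by (simp add: G_def Gq_def z_def diff inner_simps algebra_simps)
  then have "Gq - G n \<le> \<delta> * norm (q - p n)" using perturb by linarith
  then have "T * (Gq - G n) \<le> T * (\<delta> * norm (q - p n))" using T by (intro mult_left_mono) auto
  with energy show "(norm (q - p n))\<^sup>2 + T\<^sup>2 * (norm (K (u n) - y))\<^sup>2
      \<le> (norm (q - p\<^sub>0))\<^sup>2 + 2 * (T * \<delta> * norm (q - p n))"
    by (simp add: z_def field_simps)
  \<comment> \<open>The left-hand sides are the terms of the supremum that defines the dual
    functional at \<open>p n\<close> for the data \<open>K x\<close>, whose minimum is
    \<open>- j\<close>.\<close>
  show "ereal (p n \<bullet> (K v - K x)) - J v
      \<le> ereal (- j + (norm (q - p\<^sub>0))\<^sup>2 / (2 * T) + \<delta> * norm (q - p n))" for v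
  proof (cases "J v")
    case (real jv)
    have "T * (G n - Gq) \<le> (norm (q - p\<^sub>0))\<^sup>2 / 2"
      using energy by (smt (verit) divide_nonneg_pos mult_nonneg_nonneg zero_le_power2)
    then have "G n - Gq \<le> (norm (q - p\<^sub>0))\<^sup>2 / (2 * T)" using T by (simp add: field_simps)
    moreover have "p n \<bullet> (K v - K x) - jv \<le> G n + p n \<bullet> (y - K x)"
      using sub[OF n, of v] real by (simp add: G_def z_def diff inner_simps algebra_simps)
    moreover have "p n \<bullet> (y - K x) + Gq = - j - (q - p n) \<bullet> (y - K x)"
      by (simp add: Gq_def inner_simps algebra_simps)
    ultimately show ?thesis using perturb real by (simp add: abs_le_iff)
  next
    case MInf
    then show ?thesis using J by (simp add: proper_def)
  qed simp
qed

section \<open>Rates and weak cluster points under the discrepancy principle\<close>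

text \<open>Open half-spaces are weakly open.\<close>

lemma weak_cluster_point_inner:
  fixes x :: "nat \<Rightarrow> 'a::real_inner"
  assumes "weak_cluster_point x l" and "c < l \<bullet> w"
  shows "\<exists>\<^sub>F k in sequentially. c < x k \<bullet> w"
proof -
  have "openin weak_topology ((\<lambda>q. q \<bullet> w) -` {c<..})"
    unfolding weak_topology_def
    by (rule topology_generated_by_Basis) (auto intro!: exI[of _ "\<lambda>q. q \<bullet> w"] exI[of _ "{c<..}"] bounded_linear_inner_left)
  then show ?thesis using assms unfolding weak_cluster_point_def by fastforce
qed

theorem corollary4p7:
  fixes K :: "'a::{real_inner, polish_space} \<Rightarrow> 'b::{real_inner, polish_space}"
    and J :: "'a \<Rightarrow> ereal"
    and g p\<^sub>0 p_dag :: 'b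
    and u_dag :: 'a
    and \<tau> t \<delta> :: "nat \<Rightarrow> real"
    and R :: "nat \<Rightarrow> 'b \<Rightarrow> 'a"
    and R_star :: "nat \<Rightarrow> 'b \<Rightarrow> 'b"
    and \<rho> :: real
    and gs :: "nat \<Rightarrow> 'b"
    and N :: "nat \<Rightarrow> nat"
  assumes K: "bounded_linear K"
    and J: "convex_ereal J" "lower_semicontinuous J" "proper J"
    and compactness: "weakly_precompact_sublevels K J"
    and g: "attainable K J g"
    and \<tau>_pos: "\<And>n. n \<ge> 1 \<Longrightarrow> \<tau> n > 0"
    and \<tau>_bdd: "bdd_above (\<tau> ` {1..})"
    and t_def: "\<And>n. t n = (\<Sum>k=1..n. \<tau> k)"
    and t_lim: "filterlim t at_top sequentially"
    and R: "\<And>y. alm_iterates K J \<tau> p\<^sub>0 y (\<lambda>n. R n y) (\<lambda>n. R_star n y)"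
    and \<delta>_pos: "\<And>k. \<delta> k > 0"
    and \<delta>_lim: "\<delta> \<longlonglongrightarrow> 0"
    and noise: "\<And>k. norm (gs k - g) \<le> \<delta> k"
    and \<rho>: "\<rho> > 1"
    and N_def: "\<And>k. N k = morozov K R \<rho> (\<delta> k) (gs k)"
    and N_lim: "filterlim N at_top sequentially"
    and u_dag: "J_minimizing_solution K J g u_dag"
    and source: "adjoint K p_dag \<in> subdifferential J u_dag"
  shows "(\<lambda>k. norm (K (R (N k) (gs k)) - g)) \<in> O(\<lambda>k. inverse (t (N k))) \<and>
         (\<lambda>k. norm (R_star (N k) (gs k))) \<in> O(\<lambda>_. 1) \<and>
         (\<forall>p. weak_cluster_point (\<lambda>k. R_star (N k) (gs k)) p \<longrightarrow>
              is_arg_min (\<lambda>q. dual_functional K J q g) (\<lambda>_. True) p)"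
proof -
  interpret K: bounded_linear K by fact
  have adj: "adjoint K q \<bullet> x = q \<bullet> K x" for q x by (rule adjoint_inner[OF K])
  have J_ninf: "J v \<noteq> -\<infinity>" for v using J by (simp add: proper_def)
  have K_u: "K u_dag = g" and u_min: "\<And>v. K v = g \<Longrightarrow> J u_dag \<le> J v"
    using u_dag by (auto simp: J_minimizing_solution_def is_arg_min_def not_less)
  obtain v where "J v < \<infinity>" "K v = g" using g by (auto simp: attainable_def domain_def)
  then have "J u_dag < \<infinity>" using u_min[of v] by auto
  then obtain j where j: "J u_dag = ereal j" using J_ninf[of u_dag] by (cases "J u_dag") auto
  have src: "J u_dag + ereal (p_dag \<bullet> K (v - u_dag)) \<le> J v" for v
    using source by (simp add: subdifferential_def adj)
  define D where "D = norm (p_dag - p\<^sub>0)"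
  define a where "a n k = norm (p_dag - R_star n (gs k))" for n k
  define r where "r n k = norm (K (R n (gs k)) - gs k)" for n k
  have energy: "(a n k)\<^sup>2 + (t n)\<^sup>2 * (r n k)\<^sup>2 \<le> D\<^sup>2 + 2 * (t n * \<delta> k * a n k)"
    "ereal (R_star n (gs k) \<bullet> (K v - g)) - J v \<le> ereal (- j + D\<^sup>2 / (2 * t n) + \<delta> k * a n k)"
    if "n \<ge> 1" for n k v
    using alm_noisy_energy[where K = K and J = J and \<tau> = \<tau> and p\<^sub>0 = p\<^sub>0 and y = "gs k"
        and u = "\<lambda>n. R n (gs k)" and p = "\<lambda>n. R_star n (gs k)" and x = u_dag and \<delta> = "\<delta> k"
        and j = j and q = p_dag and n = n] K.linear J \<tau>_pos R noise[of k] j src that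
    by (simp_all add: K_u a_def r_def D_def t_def)
  have t_pos: "t n > 0" if "n \<ge> 1" for n unfolding t_def using that \<tau>_pos by (intro sum_pos) auto
  \<comment> \<open>If the residual is at least \<open>\<rho> * \<delta> k\<close>, completing the
    square in \<open>a n k\<close> in the energy estimate leaves \<open>(t n * \<delta> k)\<^sup>2 *
    (\<rho>\<^sup>2 - 1) \<le> D\<^sup>2\<close>.\<close>
  define \<sigma> where "\<sigma> = sqrt (\<rho>\<^sup>2 - 1)"
  have \<sigma>: "\<sigma> > 0" and \<sigma>_sq: "\<sigma>\<^sup>2 = \<rho>\<^sup>2 - 1" using \<rho> by (auto simp: \<sigma>_def one_less_power)

  have before_stop: "t n * \<delta> k \<le> D / \<sigma>" if "n \<ge> 1" "\<rho> * \<delta> k \<le> r n k" for n k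
  proof -
    have "(\<rho> * \<delta> k)\<^sup>2 \<le> (r n k)\<^sup>2" using that \<rho> \<delta>_pos[of k] by (intro power_mono) auto
    then have "(t n)\<^sup>2 * (\<rho> * \<delta> k)\<^sup>2 \<le> (t n)\<^sup>2 * (r n k)\<^sup>2" by (intro mult_left_mono) auto
    moreover have "0 \<le> (a n k - t n * \<delta> k)\<^sup>2" by simp
    ultimately have "(t n * \<delta> k * \<sigma>)\<^sup>2 \<le> D\<^sup>2"
      using energy(1)[OF that(1), of k] unfolding power_mult_distrib \<sigma>_sq
      by (simp add: power2_eq_square algebra_simps)
    then have "t n * \<delta> k * \<sigma> \<le> D" by (rule power2_le_imp_le) (simp add: D_def)
    then show ?thesis using \<sigma> by (simp add: field_simps)
  qed

  \<comment> \<open>\<open>LEAST\<close> needs a witness: as \<open>t\<close> is unbounded,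
    \<open>before_stop\<close> must fail for some \<open>n\<close>.\<close>
  have stop: "r (N k) k < \<rho> * \<delta> k" for k
  proof -
    have "\<forall>\<^sub>F n in sequentially. D / \<sigma> / \<delta> k < t n \<and> n \<ge> 1"
      using t_lim by (auto simp: filterlim_at_top_dense intro: eventually_conj eventually_ge_at_top)
    then obtain n where "D / \<sigma> / \<delta> k < t n" and n: "n \<ge> 1"
      using eventually_happens by force
    then have "\<not> t n * \<delta> k \<le> D / \<sigma>" using \<delta>_pos[of k] by (simp add: pos_divide_less_eq not_le del: divide_divide_eq_left)
    then have "n \<ge> 1 \<and> r n k < \<rho> * \<delta> k" using before_stop[of n k] n by linarith
    then have "N k \<ge> 1 \<and> r (N k) k < \<rho> * \<delta> k" unfolding N_def morozov_def r_def by (rule LeastI)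
    then show ?thesis ..
  qed

  obtain B where B: "\<And>n. n \<ge> 1 \<Longrightarrow> \<tau> n \<le> B" using \<tau>_bdd by (auto simp: bdd_above_def)
  define C where "C = 2 * (D / \<sigma>)"
  \<comment> \<open>The discrepancy test fails at \<open>N k - 1\<close>, which is at least 1 for
    large \<open>k\<close>. Once \<open>t\<close> exceeds the step bound \<open>B\<close>, one more
    step at most doubles it; hence the factor 2 in \<open>C\<close>.\<close>
  have noise_bound: "\<forall>\<^sub>F k in sequentially. N k \<ge> 1 \<and> t (N k) * \<delta> k \<le> C"
  proof -
    have "\<forall>\<^sub>F n in sequentially. B \<le> t n \<and> n \<ge> 1"
      using t_lim by (auto simp: filterlim_at_top intro: eventually_conj eventually_ge_at_top)
    then obtain n\<^sub>0 where n\<^sub>0: "\<And>n. n \<ge> n\<^sub>0 \<Longrightarrow> B \<le> t n \<and> n \<ge> 1"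
      by (auto simp: eventually_sequentially)
    have "\<forall>\<^sub>F k in sequentially. N k \<ge> Suc n\<^sub>0" using N_lim by (auto simp: filterlim_at_top)
    then show ?thesis
    proof (rule eventually_mono)
      fix k assume k: "N k \<ge> Suc n\<^sub>0"
      define n where "n = N k - 1"
      have N: "N k = Suc n" and n: "B \<le> t n" "n \<ge> 1" using k n\<^sub>0[of n] by (auto simp: n_def)
      have "n < N k" using N by simp
      then have "\<not> (n \<ge> 1 \<and> r n k < \<rho> * \<delta> k)"
        unfolding N_def morozov_def r_def by (rule not_less_Least)
      then have "t n * \<delta> k \<le> D / \<sigma>" using before_stop n by simp
      moreover have "t (N k) \<le> 2 * t n" using B[of "Suc n"] n by (simp add: N t_def)
      then have "t (N k) * \<delta> k \<le> 2 * t n * \<delta> k"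
        using \<delta>_pos[of k] by (intro mult_right_mono) auto
      ultimately show "N k \<ge> 1 \<and> t (N k) * \<delta> k \<le> C" by (simp add: C_def N)
    qed
  qed
  have D: "D \<ge> 0" by (simp add: D_def)
  then have C: "C \<ge> 0" using \<sigma> by (simp add: C_def)

  \<comment> \<open>The energy estimate becomes a quadratic inequality
    \<open>a\<^sup>2 \<le> D\<^sup>2 + 2 * C * a\<close>, which fails for
    \<open>a > D + 2 * C\<close>.\<close>
  have dual_bound: "\<forall>\<^sub>F k in sequentially. a (N k) k \<le> D + 2 * C"
    using noise_bound
  proof (rule eventually_mono)
    fix k assume k: "N k \<ge> 1 \<and> t (N k) * \<delta> k \<le> C"
    have a: "a (N k) k \<ge> 0" by (simp add: a_def)
    have "(a (N k) k)\<^sup>2 \<le> D\<^sup>2 + 2 * (t (N k) * \<delta> k * a (N k) k)"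
      using energy(1)[of "N k" k] k by (smt (verit) mult_nonneg_nonneg zero_le_power2)
    also have "\<dots> \<le> D\<^sup>2 + 2 * (C * a (N k) k)"
      using k a by (intro add_left_mono mult_left_mono mult_right_mono) auto
    finally have sq: "(a (N k) k)\<^sup>2 \<le> D\<^sup>2 + 2 * (C * a (N k) k)" .
    show "a (N k) k \<le> D + 2 * C"
    proof (rule ccontr)
      assume "\<not> a (N k) k \<le> D + 2 * C"
      then have *: "D + 2 * C < a (N k) k" by simp
      then have "(D + 2 * C) * a (N k) k < a (N k) k * a (N k) k"
        using C D by (intro mult_strict_right_mono) auto
      moreover have "D * D \<le> D * a (N k) k" using * C D by (intro mult_left_mono) auto
      ultimately show False using sq by (simp add: power2_eq_square algebra_simps)
    qed
  qed

  have primal_rate: "(\<lambda>k. norm (K (R (N k) (gs k)) - g)) \<in> O(\<lambda>k. inverse (t (N k)))"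
  proof (rule bigoI)
    show "\<forall>\<^sub>F k in sequentially. norm (norm (K (R (N k) (gs k)) - g))
        \<le> ((\<rho> + 1) * C) * norm (inverse (t (N k)))"
      using noise_bound
    proof (rule eventually_mono)
      fix k assume k: "N k \<ge> 1 \<and> t (N k) * \<delta> k \<le> C"
      then have t: "t (N k) > 0" using t_pos by simp
      have "norm (K (R (N k) (gs k)) - g) \<le> r (N k) k + norm (gs k - g)"
        unfolding r_def using norm_triangle_ineq[of "K (R (N k) (gs k)) - gs k" "gs k - g"] by simp
      also have "\<dots> \<le> (\<rho> + 1) * \<delta> k" using stop[of k] noise[of k] by (simp add: algebra_simps)
      also have "\<dots> \<le> (\<rho> + 1) * (C / t (N k))"
        using k t \<rho> by (intro mult_left_mono) (auto simp: field_simps)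
      finally show "norm (norm (K (R (N k) (gs k)) - g)) \<le> ((\<rho> + 1) * C) * norm (inverse (t (N k)))"
        using t by (simp add: field_simps)
    qed
  qed
  have dual_rate: "(\<lambda>k. norm (R_star (N k) (gs k))) \<in> O(\<lambda>_. 1)"
  proof (rule bigoI)
    show "\<forall>\<^sub>F k in sequentially. norm (norm (R_star (N k) (gs k)))
        \<le> (norm p_dag + (D + 2 * C)) * norm (1 :: real)"
      using dual_bound
    proof (rule eventually_mono)
      fix k assume "a (N k) k \<le> D + 2 * C"
      then show "norm (norm (R_star (N k) (gs k))) \<le> (norm p_dag + (D + 2 * C)) * norm (1 :: real)"
        using norm_triangle_sub[of "R_star (N k) (gs k)" p_dag] by (simp add: a_def norm_minus_commute)
    qed
  qed

  have t_N: "filterlim (\<lambda>k. t (N k)) at_top sequentially" using filterlim_compose[OF t_lim N_lim] .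
  have gap: "(\<lambda>k. D\<^sup>2 / (2 * t (N k)) + \<delta> k * (D + 2 * C)) \<longlonglongrightarrow> 0"
  proof -
    have "(\<lambda>k. D\<^sup>2 / (2 * t (N k))) \<longlonglongrightarrow> 0"
      by (intro real_tendsto_divide_at_top[OF tendsto_const]
          filterlim_tendsto_pos_mult_at_top[OF tendsto_const _ t_N]) simp
    moreover have "(\<lambda>k. \<delta> k * (D + 2 * C)) \<longlonglongrightarrow> 0" using tendsto_mult_right[OF \<delta>_lim] by simp
    ultimately show ?thesis using tendsto_add by fastforce
  qed
  have cluster: "is_arg_min (\<lambda>q. dual_functional K J q g) (\<lambda>_. True) p"
    if p: "weak_cluster_point (\<lambda>k. R_star (N k) (gs k)) p" for p
  proof -
    \<comment> \<open>Testing the supremum with \<open>u_dag\<close> bounds the functional below by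
      \<open>- j\<close>, so it remains to bound its value at \<open>p\<close> above by
      \<open>- j\<close>.\<close>
    have lower: "ereal (- j) \<le> dual_functional K J q g" for q
    proof -
      have "ereal (q \<bullet> g) - ereal j \<le> conjugate J (adjoint K q)"
        unfolding conjugate_def by (rule SUP_upper2[of u_dag]) (auto simp: adj K_u j)
      then show ?thesis unfolding dual_functional_def
        by (cases "conjugate J (adjoint K q)") auto
    qed
    have "ereal (adjoint K p \<bullet> v) - J v \<le> ereal (- j + p \<bullet> g)" for v
    proof (cases "J v")
      case (real jv)
      have "p \<bullet> (K v - g) \<le> jv - j"
      proof (rule ccontr)
        assume "\<not> p \<bullet> (K v - g) \<le> jv - j"
        \<comment> \<open>The half-space with this slack contains \<open>p\<close>, so the dual
          iterates visit it frequently, whereas by \<open>energy\<close> and \<open>gap\<close> they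
          eventually stay outside.\<close>
        then obtain e where e: "e > 0" "jv - j + e < p \<bullet> (K v - g)"
          by (metis add.commute field_le_epsilon linorder_not_less order_less_imp_le)
        have "\<forall>\<^sub>F k in sequentially. D\<^sup>2 / (2 * t (N k)) + \<delta> k * (D + 2 * C) < e"
          using order_tendstoD(2)[OF gap e(1)] .
        then have "\<forall>\<^sub>F k in sequentially. R_star (N k) (gs k) \<bullet> (K v - g) \<le> jv - j + e"
          using dual_bound noise_bound
        proof eventually_elim
          case (elim k)
          have "\<delta> k * a (N k) k \<le> \<delta> k * (D + 2 * C)"
            using elim(2) \<delta>_pos[of k] by (intro mult_left_mono) auto
          then show ?case using energy(2)[of "N k" k v] elim real by simp
        qed
        with weak_cluster_point_inner[OF p e(2)] show False
          by (auto simp: frequently_def not_less)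
      qed
      then show ?thesis by (simp add: real adj inner_simps)
    qed (use J_ninf in auto)
    then have "conjugate J (adjoint K p) \<le> ereal (- j + p \<bullet> g)"
      unfolding conjugate_def by (rule SUP_least)
    then have "dual_functional K J p g \<le> ereal (- j)"
      unfolding dual_functional_def by (cases "conjugate J (adjoint K p)") auto
    with lower show ?thesis unfolding is_arg_min_def by (meson leD order_le_less_trans order_trans)
  qed
  show ?thesis using primal_rate dual_rate cluster by blast
qed

end
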